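(* Let $R\ge 1$ and let $\{X_m\}_{m\ge 0}$ be the state-dependent $(1,R)$-reflecting random walk on $\{0,1,2,\dots\}$ with $X_0=0$ described in the context. Define $$\mu(0)=1,\qquad \mu(1)=\frac{1}{q(1)}\,\alpha e_1',\qquad \mu(i)=\frac{1}{q(i)}\,\alpha M_1M_2\cdots M_{i-1}e_1'\quad (i\ge 2).$$ Then: (i) $(\mu(i))_{i\ge 0}$ is a stationary measure of $\{X_m\}_{m\ge 0}$. (ii) If $\sum_{i=0}^{\infty}\mu(i)<\infty$, then $\{X_m\}_{m\ge 0}$ is positive recurrent, and its stationary distribution is $$\pi(i)=\frac{\mu(i)}{\sum_{j=0}^{\infty}\mu(j)},\qquad i\ge 0.$$
   Context: The state-dependent $(1,R)$-reflecting random walk is the Markov chain $\{X_m\}_{m\ge0}$ on $\{0,1,2,\dots\}$ with $X_0=0$ and transition probabilities $P_{ij}$ given, for $i\ge 0$, by $P_{ii}=r(i)$, $P_{i,i-1}=q(i)$ (with $q(0)=0$), $P_{ij}=p_{j-i}(i)$ for $i<j\le i+R$, and $P_{ij}=0$ otherwise. Here $r(i)\ge 0$, $p_1(i),\dots,p_R(i)\ge 0$, $r(i)+q(i)+p_1(i)+\cdots+p_R(i)=1$ for all $i\ge 0$, and $0<q(i)<1$ for $i\ge 1$. The chain is irreducible. Notation: $\alpha_k=p_k(0)+p_{k+1}(0)+\cdots+p_R(0)$ for $1\le k\le R$; $\alpha=(\alpha_1,\dots,\alpha_R)$ and $e_1=(1,0,\dots,0)$ are row vectors in $\mathbb{R}^R$;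 $'$ denotes transpose. For $i\ge 1$ and $1\le k\le R$, $\theta_k(i)=\dfrac{p_k(i)+p_{k+1}(i)+\cdots+p_R(i)}{q(i)}$. $M_i$ ($i\ge1$) is the $R\times R$ matrix whose first row is $(\theta_1(i),\theta_2(i),\dots,\theta_R(i))$, whose entries in positions $(k+1,k)$, $1\le k\le R-1$, equal $1$, and whose other entries are $0$. A stationary measure is a nonnegative (nonzero) measure $\mu$ with $\sum_i \mu(i)P_{ij}=\mu(j)$ for all $j$. *)

theory Defs
  imports "HOL-Probability.Probability" "Jordan_Normal_Form.Matrix"
begin

section \<open>Markov chains on the natural numbers\<close>

definition markov_chain ::
  "'a measure \<Rightarrow> (nat \<Rightarrow> nat \<Rightarrow> real) \<Rightarrow> (nat \<Rightarrow> 'a \<Rightarrow> nat) \<Rightarrow> bool" where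
  "markov_chain \<Omega> P X \<longleftrightarrow>
     prob_space \<Omega> \<and>
     (\<forall>m. X m \<in> measurable \<Omega> (count_space UNIV)) \<and>
     (\<forall>m x j. \<P>(\<omega> in \<Omega>. \<forall>k\<le>m. X k \<omega> = x k) > 0 \<longrightarrow>
        \<P>(\<omega> in \<Omega>. X (Suc m) \<omega> = j \<bar> \<forall>k\<le>m. X k \<omega> = x k) = P (x m) j)"

fun n_step :: "(nat \<Rightarrow> nat \<Rightarrow> real) \<Rightarrow> nat \<Rightarrow> nat \<Rightarrow> nat \<Rightarrow> real" where
  "n_step P 0 i j = (if i = j then 1 else 0)"
| "n_step P (Suc n) i j = (\<Sum>k. P i k * n_step P n k j)"

definition irreducible_kernel :: "(nat \<Rightarrow> nat \<Rightarrow> real) \<Rightarrow> bool" where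
  "irreducible_kernel P \<longleftrightarrow> (\<forall>i j. \<exists>n. n_step P n i j > 0)"

definition stationary_measure :: "(nat \<Rightarrow> nat \<Rightarrow> real) \<Rightarrow> (nat \<Rightarrow> real) \<Rightarrow> bool" where
  "stationary_measure P \<nu> \<longleftrightarrow>
     (\<forall>i. \<nu> i \<ge> 0) \<and> (\<exists>i. \<nu> i \<noteq> 0) \<and> (\<forall>j. (\<lambda>i. \<nu> i * P i j) sums \<nu> j)"

definition stationary_distribution :: "(nat \<Rightarrow> nat \<Rightarrow> real) \<Rightarrow> (nat \<Rightarrow> real) \<Rightarrow> bool" where
  "stationary_distribution P \<nu> \<longleftrightarrow> stationary_measure P \<nu> \<and> \<nu> sums 1"

text \<open>The waiting time after time \<open>n\<close> until the next visit to \<open>j\<close>; it is \<open>\<infinity>\<close> (the infimum of the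
  empty set) if there is none.\<close>

definition return_time :: "(nat \<Rightarrow> 'a \<Rightarrow> nat) \<Rightarrow> nat \<Rightarrow> nat \<Rightarrow> 'a \<Rightarrow> ennreal" where
  "return_time X n j \<omega> = (INF m\<in>{m. m \<ge> 1 \<and> X (n + m) \<omega> = j}. of_nat m)"

text \<open>The conditional expectation of the return time to \<open>j\<close> given \<open>X n = j\<close>. By the Markov property
  it equals the usual mean return time of the chain started in \<open>j\<close>, for every \<open>n\<close> such that
  the event \<open>X n = j\<close> has positive probability; it carries no information for other \<open>n\<close>.\<close>

definition mean_return_time :: "'a measure \<Rightarrow> (nat \<Rightarrow> 'a \<Rightarrow> nat) \<Rightarrow> nat \<Rightarrow> nat \<Rightarrow> ennreal" where
  "mean_return_time \<Omega> X n j =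
     (\<integral>\<^sup>+ \<omega>. return_time X n j \<omega> \<partial>uniform_measure \<Omega> {\<omega> \<in> space \<Omega>. X n \<omega> = j})"

text \<open>Every state is visited with positive probability and has finite mean return time. Finiteness
  of the mean includes recurrence, since the return time takes the value \<open>\<infinity>\<close> when there is no
  return.\<close>

definition positive_recurrent :: "'a measure \<Rightarrow> (nat \<Rightarrow> 'a \<Rightarrow> nat) \<Rightarrow> bool" where
  "positive_recurrent \<Omega> X \<longleftrightarrow>
     (\<forall>j. (\<exists>n. \<P>(\<omega> in \<Omega>. X n \<omega> = j) > 0) \<and>
          (\<forall>n. \<P>(\<omega> in \<Omega>. X n \<omega> = j) > 0 \<longrightarrow> mean_return_time \<Omega> X n j < \<infinity>))"

section \<open>The reflecting random walk\<close>

text \<open>Here \<open>p k i\<close> is the probability of a jump from \<open>i\<close> to \<open>i + k\<close>.\<close>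

definition walk_kernel ::
  "nat \<Rightarrow> (nat \<Rightarrow> real) \<Rightarrow> (nat \<Rightarrow> real) \<Rightarrow> (nat \<Rightarrow> nat \<Rightarrow> real) \<Rightarrow> nat \<Rightarrow> nat \<Rightarrow> real" where
  "walk_kernel R r q p i j =
     (if j = i then r i
      else if Suc j = i then q i
      else if i < j \<and> j \<le> i + R then p (j - i) i
      else 0)"

definition \<theta> :: "nat \<Rightarrow> (nat \<Rightarrow> real) \<Rightarrow> (nat \<Rightarrow> nat \<Rightarrow> real) \<Rightarrow> nat \<Rightarrow> nat \<Rightarrow> real" where
  "\<theta> R q p k i = (\<Sum>l=k..R. p l i) / q i"

text \<open>Vectors and matrices are indexed from \<open>0\<close>, so coordinate \<open>k\<close> below is coordinate \<open>k + 1\<close>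
  in the usual numbering \<open>1, \<dots>, R\<close>.\<close>

definition \<alpha>_vec :: "nat \<Rightarrow> (nat \<Rightarrow> nat \<Rightarrow> real) \<Rightarrow> real vec" where
  "\<alpha>_vec R p = vec R (\<lambda>k. \<Sum>l=k+1..R. p l 0)"

definition M_mat :: "nat \<Rightarrow> (nat \<Rightarrow> real) \<Rightarrow> (nat \<Rightarrow> nat \<Rightarrow> real) \<Rightarrow> nat \<Rightarrow> real mat" where
  "M_mat R q p i = mat R R (\<lambda>(a, b).
     if a = 0 then \<theta> R q p (b + 1) i
     else if a = b + 1 then 1
     else 0)"

definition \<mu> :: "nat \<Rightarrow> (nat \<Rightarrow> real) \<Rightarrow> (nat \<Rightarrow> nat \<Rightarrow> real) \<Rightarrow> nat \<Rightarrow> real" where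
  "\<mu> R q p i =
     (if i = 0 then 1
      else if i = 1 then 1 / q 1 * scalar_prod (\<alpha>_vec R p) (unit_vec R 0)
      else 1 / q i * scalar_prod (\<alpha>_vec R p)
             (foldr (*) (map (M_mat R q p) [1..<i]) (1\<^sub>m R) *\<^sub>v unit_vec R 0))"

end

theory Submission
  imports Defs
begin

text \<open>The walk moves down by at most one, so a cut between \<open>{0, \<dots>, j - 1}\<close> and
  \<open>{j, j + 1, \<dots>}\<close> is crossed downwards only by the step \<open>j \<rightarrow> j - 1\<close>. For
  any weights \<open>\<nu>\<close> the net flux across this cut is a finite sum, and the defect of the balance equation
  at \<open>j\<close> is the difference of the fluxes across the two cuts next to \<open>j\<close>. As the flux vanishes
  at the bottom, \<open>\<nu>\<close> is invariant iff it vanishes at every cut (\<open>invariant_iff_cut_equations\<close>).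
  The cut equations express \<open>\<nu> j\<close> through \<open>\<nu> 0, \<dots>, \<nu> (j - 1)\<close>, because
  \<open>q j > 0\<close>. This gives uniqueness up to a factor (\<open>cut_equations_unique\<close>) without any ergodic
  theory. The matrices \<open>M\<close> carry out this recursion: the entries of the row vector
  \<open>\<alpha> M\<^sub>1 \<cdots> M\<^sub>n\<^sub>-\<^sub>1\<close> are the rates at which jumps from below \<open>n\<close> reach at
  least \<open>n, n + 1, \<dots>\<close> (\<open>\<alpha>_M_prod_eq_overshoot\<close>).

  Positive recurrence needs only one half of Kac's formula, and that half comes from a telescoping
  sum. Let \<open>a m\<close> be the mass of the stationary measure \<open>\<nu>\<close> on the paths that avoid \<open>j\<close> at the
  times \<open>1, \<dots>, m\<close>. By invariance \<open>a m - a (Suc m)\<close> is the part of this mass that starts in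
  \<open>j\<close>, namely \<open>\<nu> j\<close> times the probability that the return time to \<open>j\<close> exceeds \<open>m\<close>.
  Summing over \<open>m\<close> bounds \<open>\<nu> j\<close> times the mean return time by the total mass
  (\<open>stationary_avoid_sum_le\<close>), and irreducibility makes \<open>\<nu> j\<close> positive. What remains is to
  identify the avoidance probabilities computed from the kernel with those of the process, which
  is the Markov property applied step by step (\<open>emeasure_avoid_history\<close>, \<open>forget_past\<close>).\<close>

section \<open>Stationarity as vanishing of the net flux across every cut\<close>

definition jump_tail :: "nat \<Rightarrow> (nat \<Rightarrow> nat \<Rightarrow> real) \<Rightarrow> nat \<Rightarrow> nat \<Rightarrow> real" where
  "jump_tail R p k i = (\<Sum>l=k..R. p l i)"

lemma jump_tail_rec:
  assumes "k \<ge> 1"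
  shows "jump_tail R p k i = (if k \<le> R then p k i else 0) + jump_tail R p (Suc k) i"
  by (auto simp: jump_tail_def sum.atLeast_Suc_atMost)

lemma walk_kernel_inflow_sums:
  "(\<lambda>i. \<nu> i * walk_kernel R r q p i j) sums
     (\<nu> j * r j + \<nu> (Suc j) * q (Suc j) + (\<Sum>i<j. \<nu> i * (if j - i \<le> R then p (j - i) i else 0)))"
proof -
  let ?f = "\<lambda>i. \<nu> i * walk_kernel R r q p i j"
  have "?f sums sum ?f {..Suc j}"
    by (rule sums_finite) (auto simp: walk_kernel_def)
  moreover have "sum ?f {..<j} = (\<Sum>i<j. \<nu> i * (if j - i \<le> R then p (j - i) i else 0))"
    by (rule sum.cong) (auto simp: walk_kernel_def)
  then have "sum ?f {..Suc j} = \<nu> j * r j + \<nu> (Suc j) * q (Suc j)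
      + (\<Sum>i<j. \<nu> i * (if j - i \<le> R then p (j - i) i else 0))"
    by (simp add: lessThan_Suc_atMost[symmetric] walk_kernel_def)
  ultimately show ?thesis by simp
qed

text \<open>The defect of the balance equation is a difference of consecutive net fluxes, so it vanishes
  everywhere iff the flux is constant. The flux at the cut below \<open>0\<close> is \<open>0\<close>.\<close>

lemma invariant_iff_cut_equations:
  assumes row: "\<And>i. r i + q i + (\<Sum>k=1..R. p k i) = 1" and q0: "q 0 = 0"
  shows "(\<forall>j. (\<lambda>i. \<nu> i * walk_kernel R r q p i j) sums \<nu> j) \<longleftrightarrow>
    (\<forall>j. \<nu> j * q j = (\<Sum>i<j. \<nu> i * jump_tail R p (j - i) i))"
proof -
  \<comment> \<open>\<open>D j\<close> is the net downward flux across the cut below \<open>j\<close>, \<open>I j\<close> the total inflow into \<open>j\<close>.\<close>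
  define D where "D j = \<nu> j * q j - (\<Sum>i<j. \<nu> i * jump_tail R p (j - i) i)" for j
  define I where "I j = \<nu> j * r j + \<nu> (Suc j) * q (Suc j)
    + (\<Sum>i<j. \<nu> i * (if j - i \<le> R then p (j - i) i else 0))" for j
  have flux: "I j - \<nu> j = D (Suc j) - D j" for j
  proof -
    have "(\<Sum>i<j. \<nu> i * jump_tail R p (j - i) i)
        = (\<Sum>i<j. \<nu> i * (if j - i \<le> R then p (j - i) i else 0)
            + \<nu> i * jump_tail R p (Suc j - i) i)"
    proof (rule sum.cong)
      fix i assume "i \<in> {..<j}"
      then have "1 \<le> j - i" "Suc (j - i) = Suc j - i" by auto
      then show "\<nu> i * jump_tail R p (j - i) i = \<nu> i * (if j - i \<le> R then p (j - i) i else 0)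
            + \<nu> i * jump_tail R p (Suc j - i) i"
        using jump_tail_rec[of "j - i" R p i] by (simp add: distrib_left)
    qed simp
    then have split: "(\<Sum>i<j. \<nu> i * jump_tail R p (j - i) i)
        = (\<Sum>i<j. \<nu> i * (if j - i \<le> R then p (j - i) i else 0))
          + (\<Sum>i<j. \<nu> i * jump_tail R p (Suc j - i) i)"
      by (simp only: sum.distrib)
    have "jump_tail R p 1 j = 1 - r j - q j"
      using row[of j] by (simp add: jump_tail_def)
    moreover have "Suc j - j = 1" by simp
    ultimately have "\<nu> j * jump_tail R p (Suc j - j) j = \<nu> j - \<nu> j * r j - \<nu> j * q j"
      by (simp only: right_diff_distrib mult_1_right)
    then show ?thesis
      unfolding I_def D_def split sum.lessThan_Suc by linarith
  qed
  have "(\<lambda>i. \<nu> i * walk_kernel R r q p i j) sums \<nu> j \<longleftrightarrow> D (Suc j) = D j" for j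
  proof -
    have "(\<lambda>i. \<nu> i * walk_kernel R r q p i j) sums I j"
      unfolding I_def by (rule walk_kernel_inflow_sums)
    then have "(\<lambda>i. \<nu> i * walk_kernel R r q p i j) sums \<nu> j \<longleftrightarrow> I j = \<nu> j"
      by (auto dest: sums_unique2)
    then show ?thesis using flux[of j] by auto
  qed
  then have "(\<forall>j. (\<lambda>i. \<nu> i * walk_kernel R r q p i j) sums \<nu> j) \<longleftrightarrow> (\<forall>j. D (Suc j) = D j)"
    by simp
  also have "\<dots> \<longleftrightarrow> (\<forall>j. D j = 0)"
  proof
    assume *: "\<forall>j. D (Suc j) = D j"
    show "\<forall>j. D j = 0"
    proof
      fix j show "D j = 0"
        by (induction j) (use * in \<open>auto simp: D_def q0\<close>)
    qed
  qed simp
  finally show ?thesis by (simp add: D_def)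
qed

text \<open>Strong induction: the cut equation at \<open>j\<close> is linear in the earlier values, and
  \<open>q j \<noteq> 0\<close> lets it be solved for the value at \<open>j\<close>.\<close>

lemma cut_equations_unique:
  assumes qpos: "\<And>i. i \<ge> 1 \<Longrightarrow> 0 < q i"
    and \<nu>: "\<And>j. \<nu> j * q j = (\<Sum>i<j. \<nu> i * jump_tail R p (j - i) i)"
    and \<rho>: "\<And>j. \<rho> j * q j = (\<Sum>i<j. \<rho> i * jump_tail R p (j - i) i)"
    and init: "\<rho> 0 = 1"
  shows "\<nu> j = \<nu> 0 * \<rho> j"
proof (induction j rule: less_induct)
  case (less j)
  show ?case
  proof (cases "j = 0")
    case False
    have "(\<Sum>i<j. \<nu> i * jump_tail R p (j - i) i)
        = (\<Sum>i<j. \<nu> 0 * (\<rho> i * jump_tail R p (j - i) i))"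
    proof (rule sum.cong[OF refl])
      fix i assume "i \<in> {..<j}"
      then have "\<nu> i = \<nu> 0 * \<rho> i" by (intro less) simp
      then show "\<nu> i * jump_tail R p (j - i) i = \<nu> 0 * (\<rho> i * jump_tail R p (j - i) i)"
        by (simp only: mult.assoc)
    qed
    then have "\<nu> j * q j = \<nu> 0 * (\<rho> j * q j)"
      by (simp only: \<nu>[of j] \<rho>[of j] sum_distrib_left)
    then show ?thesis using qpos[of j] False by auto
  qed (simp add: init)
qed

section \<open>The matrix products as overshoot rates\<close>

abbreviation M_prod :: "nat \<Rightarrow> (nat \<Rightarrow> real) \<Rightarrow> (nat \<Rightarrow> nat \<Rightarrow> real) \<Rightarrow> nat \<Rightarrow> real mat" where
  "M_prod R q p n \<equiv> foldr (*) (map (M_mat R q p) [1..<n]) (1\<^sub>m R)"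

lemma foldr_mult_mat:
  assumes "set As \<subseteq> carrier_mat n n" "B \<in> carrier_mat n n"
  shows "foldr (*) As (1\<^sub>m n) \<in> carrier_mat n n"
    and "foldr (*) As B = foldr (*) As (1\<^sub>m n) * (B :: real mat)"
  using assms
proof (induction As)
  case (Cons A As)
  {
    case 1
    then show ?case using Cons.IH(1) by auto
  next
    case 2
    then have "foldr (*) As B = foldr (*) As (1\<^sub>m n) * B" "foldr (*) As (1\<^sub>m n) \<in> carrier_mat n n"
      using Cons.IH by auto
    with 2 show ?case
      by (auto simp: assoc_mult_mat[of A n n _ n _ n])
  }
qed auto

text \<open>A column of the companion-type matrix \<open>M\<close>: its top entry feeds in the jumps that start
  at \<open>n\<close>, and its subdiagonal entry passes on the overshoot with its index lowered by one, since the
  reference level rises from \<open>n\<close> to \<open>n + 1\<close>. In the last column there is nothing left to pass on.\<close>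

lemma M_mat_unit_vec:
  assumes "b < R"
  shows "M_mat R q p n *\<^sub>v unit_vec R b =
    \<theta> R q p (Suc b) n \<cdot>\<^sub>v unit_vec R 0 + (if Suc b < R then unit_vec R (Suc b) else 0\<^sub>v R)"
proof (rule eq_vecI)
  let ?v = "\<theta> R q p (Suc b) n \<cdot>\<^sub>v unit_vec R 0 + (if Suc b < R then unit_vec R (Suc b) else 0\<^sub>v R)"
  fix i assume "i < dim_vec ?v"
  then have i: "i < R" by (auto split: if_splits)
  have "(M_mat R q p n *\<^sub>v unit_vec R b) $ i = M_mat R q p n $$ (i, b)"
    using i assms by (simp add: M_mat_def)
  also have "\<dots> = ?v $ i"
    using i assms by (auto simp: M_mat_def)
  finally show "(M_mat R q p n *\<^sub>v unit_vec R b) $ i = ?v $ i" .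
qed (simp add: M_mat_def)

text \<open>The \<open>k\<close>-th entry of \<open>\<alpha> M\<^sub>1 \<cdots> M\<^sub>n\<^sub>-\<^sub>1\<close> is the flow of jumps that
  start below \<open>n\<close> and land at \<open>n + k\<close> or beyond. For \<open>k = 0\<close> this is the upward part of the cut
  equation at \<open>n\<close>; the other entries are needed for the induction.\<close>

lemma \<alpha>_M_prod_eq_overshoot:
  fixes R :: nat
  assumes qpos: "\<And>i. i \<ge> 1 \<Longrightarrow> 0 < q i" and "n \<ge> 1" "k < R"
  shows "scalar_prod (\<alpha>_vec R p) (M_prod R q p n *\<^sub>v unit_vec R k) =
    (\<Sum>i<n. \<mu> R q p i * jump_tail R p (n - i + k) i)"
  using assms(2,3)
proof (induction n arbitrary: k rule: nat_induct_at_least)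
  case base
  then show ?case
    by (simp add: \<alpha>_vec_def \<mu>_def jump_tail_def)
next
  case (Suc n)
  let ?a = "\<alpha>_vec R p" and ?M = "M_prod R q p n"
  have a: "?a \<in> carrier_vec R" by (simp add: \<alpha>_vec_def)
  have Mn: "M_mat R q p m \<in> carrier_mat R R" for m by (simp add: M_mat_def)
  have M: "?M \<in> carrier_mat R R"
    by (rule foldr_mult_mat[where B = "1\<^sub>m R"]) (use Mn in auto)
  have step: "M_prod R q p (Suc n) = ?M * M_mat R q p n"
    using Suc.hyps foldr_mult_mat(2)[of "map (M_mat R q p) [1..<n]" R "M_mat R q p n"] Mn
    by (auto simp: right_mult_one_mat[OF Mn])
  have \<mu>n: "\<mu> R q p n * q n = scalar_prod ?a (?M *\<^sub>v unit_vec R 0)"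
    using Suc.hyps qpos[of n] by (cases "n = 1") (auto simp: \<mu>_def)
  have e0: "unit_vec R 0 \<in> carrier_vec R" by simp
  let ?rest = "if Suc k < R then unit_vec R (Suc k) else 0\<^sub>v R :: real vec"
  have rest: "?rest \<in> carrier_vec R" by simp
  have lin: "scalar_prod ?a (?M *\<^sub>v (c \<cdot>\<^sub>v unit_vec R 0 + w))
      = c * scalar_prod ?a (?M *\<^sub>v unit_vec R 0) + scalar_prod ?a (?M *\<^sub>v w)"
    if w: "w \<in> carrier_vec R" for c w
  proof -
    have "?M *\<^sub>v (c \<cdot>\<^sub>v unit_vec R 0 + w) = c \<cdot>\<^sub>v (?M *\<^sub>v unit_vec R 0) + ?M *\<^sub>v w"
      using mult_add_distrib_mat_vec[OF M smult_carrier_vec[THEN iffD2, OF e0] w]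
        mult_mat_vec[OF M e0] by simp
    then show ?thesis
      using scalar_prod_add_distrib[OF a] M e0 w a by (simp add: mult_mat_vec_carrier)
  qed
  have "scalar_prod ?a (M_prod R q p (Suc n) *\<^sub>v unit_vec R k)
      = scalar_prod ?a (?M *\<^sub>v (\<theta> R q p (Suc k) n \<cdot>\<^sub>v unit_vec R 0 + ?rest))"
    by (simp only: step assoc_mult_mat_vec[OF M Mn unit_vec_carrier] M_mat_unit_vec[OF Suc.prems])
  also have "\<dots> = \<theta> R q p (Suc k) n * scalar_prod ?a (?M *\<^sub>v unit_vec R 0)
      + scalar_prod ?a (?M *\<^sub>v ?rest)"
    by (rule lin[OF rest])
  also have "scalar_prod ?a (?M *\<^sub>v ?rest)
      = (\<Sum>i<n. \<mu> R q p i * jump_tail R p (Suc n - i + k) i)"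
  proof (cases "Suc k < R")
    case True
    have "(\<Sum>i<n. \<mu> R q p i * jump_tail R p (n - i + Suc k) i)
      = (\<Sum>i<n. \<mu> R q p i * jump_tail R p (Suc n - i + k) i)"
      by (rule sum.cong) (auto simp: Suc_diff_le)
    then show ?thesis using Suc.IH[OF True] True by simp
  next
    \<comment> \<open>For \<open>k = R - 1\<close> the jumps would have to be longer than \<open>R\<close>, so every tail sum is empty.\<close>
    case False
    have z: "?M *\<^sub>v 0\<^sub>v R = 0\<^sub>v R" using M by (intro eq_vecI) auto
    have "scalar_prod ?a (?M *\<^sub>v ?rest) = 0" using False z a by simp
    moreover have "(\<Sum>i<n. \<mu> R q p i * jump_tail R p (Suc n - i + k) i) = 0"
      using False by (intro sum.neutral) (auto simp: jump_tail_def)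
    ultimately show ?thesis by simp
  qed
  also have "\<theta> R q p (Suc k) n * scalar_prod ?a (?M *\<^sub>v unit_vec R 0)
      = \<mu> R q p n * jump_tail R p (Suc n - n + k) n"
    unfolding \<mu>n[symmetric] using qpos[of n] Suc.hyps by (simp add: \<theta>_def jump_tail_def)
  finally show ?case by simp
qed

lemma \<mu>_cut_equations:
  assumes "R \<ge> 1" "q 0 = 0" and qpos: "\<And>i. i \<ge> 1 \<Longrightarrow> 0 < q i"
  shows "\<mu> R q p j * q j = (\<Sum>i<j. \<mu> R q p i * jump_tail R p (j - i) i)"
proof (cases "j = 0")
  case False
  then have "\<mu> R q p j * q j = scalar_prod (\<alpha>_vec R p) (M_prod R q p j *\<^sub>v unit_vec R 0)"
    using qpos[of j] by (cases "j = 1") (auto simp: \<mu>_def)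
  then show ?thesis
    using \<alpha>_M_prod_eq_overshoot[where q = q and n = j and k = 0 and R = R and p = p]
      qpos False assms(1) by simp
qed (use assms in simp)

lemma \<mu>_nonneg:
  assumes "R \<ge> 1" "q 0 = 0" and qpos: "\<And>i. i \<ge> 1 \<Longrightarrow> 0 < q i"
    and p: "\<And>k i. 1 \<le> k \<Longrightarrow> k \<le> R \<Longrightarrow> p k i \<ge> 0"
  shows "\<mu> R q p j \<ge> 0"
proof (induction j rule: less_induct)
  case (less j)
  show ?case
  proof (cases "j = 0")
    case False
    have "0 \<le> (\<Sum>i<j. \<mu> R q p i * jump_tail R p (j - i) i)"
      using less p by (auto intro!: sum_nonneg mult_nonneg_nonneg simp: jump_tail_def)
    then have "0 \<le> \<mu> R q p j * q j"
      using \<mu>_cut_equations[where q = q, OF assms(1-3), of p j] by simp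
    then show ?thesis using qpos[of j] False by (simp add: zero_le_mult_iff)
  qed (simp add: \<mu>_def)
qed

section \<open>Avoidance probabilities under an invariant measure\<close>

definition stochastic_kernel :: "(nat \<Rightarrow> nat \<Rightarrow> real) \<Rightarrow> bool" where
  "stochastic_kernel P \<longleftrightarrow> (\<forall>i j. 0 \<le> P i j) \<and> (\<forall>i. P i sums 1)"

lemma stochastic_walk_kernel:
  assumes r: "\<And>i. r i \<ge> 0" and p: "\<And>k i. 1 \<le> k \<Longrightarrow> k \<le> R \<Longrightarrow> p k i \<ge> 0"
    and row: "\<And>i. r i + q i + (\<Sum>k=1..R. p k i) = 1" and q0: "q 0 = 0"
    and qpos: "\<And>i. i \<ge> 1 \<Longrightarrow> 0 < q i"
  shows "stochastic_kernel (walk_kernel R r q p)"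
proof -
  let ?W = "walk_kernel R r q p"
  have "0 \<le> ?W i j" for i j
    using r p qpos[of i] by (auto simp: walk_kernel_def less_imp_le)
  moreover have "?W i sums 1" for i
  proof -
    have "?W i sums sum (?W i) {..i + R}"
      by (rule sums_finite) (auto simp: walk_kernel_def)
    also have "{..i + R} = {..<i} \<union> {i} \<union> {i+1..i+R}" by auto
    also have "sum (?W i) \<dots> = sum (?W i) {..<i} + ?W i i + sum (?W i) {i+1..i+R}"
      by (subst sum.union_disjoint; force)+
    also have "sum (?W i) {..<i} = q i"
    proof (cases i)
      case (Suc m)
      then have "sum (?W i) {..<i} = (\<Sum>j\<in>{m}. ?W i j)"
        by (intro sum.mono_neutral_right) (auto simp: walk_kernel_def)
      then show ?thesis using Suc by (simp add: walk_kernel_def)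
    qed (simp add: q0)
    also have "sum (?W i) {i+1..i+R} = (\<Sum>k=1..R. p k i)"
      by (rule sum.reindex_bij_witness[of _ "\<lambda>k. i + k" "\<lambda>j. j - i"]) (auto simp: walk_kernel_def)
    also have "q i + ?W i i + (\<Sum>k=1..R. p k i) = 1"
      using row[of i] by (simp add: walk_kernel_def)
    finally show ?thesis .
  qed
  ultimately show ?thesis by (simp add: stochastic_kernel_def)
qed

text \<open>Summability is part of the induction because a divergent series would leave the value of
  \<open>n_step\<close> unspecified.\<close>

lemma n_step_bounds:
  assumes P: "stochastic_kernel P"
  shows "0 \<le> n_step P n i j \<and> n_step P n i j \<le> 1 \<and> summable (\<lambda>k. P i k * n_step P n k j)"
proof (induction n arbitrary: i)
  have nn: "0 \<le> P i k" and s: "summable (P i)" and one: "suminf (P i) = 1" for i k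
    using P by (auto simp: stochastic_kernel_def sums_iff)
  {
    case 0
    show ?case by (auto intro!: summable_comparison_test'[OF s[of i], of 0] simp: nn)
  next
    case (Suc n)
    have *: "0 \<le> n_step P (Suc n) i j \<and> n_step P (Suc n) i j \<le> 1" for i
    proof -
      have "(\<Sum>k. P i k * n_step P n k j) \<le> suminf (P i)"
        using Suc nn s by (intro suminf_le) (auto intro: mult_left_le)
      moreover have "0 \<le> (\<Sum>k. P i k * n_step P n k j)"
        using Suc nn by (intro suminf_nonneg) auto
      ultimately show ?thesis using one by simp
    qed
    have "summable (\<lambda>k. P i k * n_step P (Suc n) k j)"
      by (rule summable_comparison_test'[OF s[of i], of 0])
        (use * nn in \<open>simp add: abs_mult mult_left_le del: n_step.simps\<close>)
    with * show ?case by blast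
  }
qed

text \<open>A positive entry of the \<open>n\<close>-step kernel forces a chain of \<open>n\<close> transitions of positive
  probability. This transports both the positivity of a stationary measure and the positivity
  of a visiting probability from one state to all others.\<close>

lemma irreducible_closed_imp_all:
  assumes P: "stochastic_kernel P" and irr: "irreducible_kernel P" and "S i"
    and closed: "\<And>i k. S i \<Longrightarrow> P i k > 0 \<Longrightarrow> S k"
  shows "S j"
proof -
  obtain n where "n_step P n i j > 0" using irr by (auto simp: irreducible_kernel_def)
  then show ?thesis using \<open>S i\<close>
  proof (induction n arbitrary: i)
    case 0
    then show ?case by (auto split: if_splits)
  next
    case (Suc n)
    have "\<exists>k. P i k * n_step P n k j \<noteq> 0"
    proof (rule ccontr)
      assume "\<not> ?thesis"
      then have "(\<lambda>k. P i k * n_step P n k j) = (\<lambda>_. 0)" by auto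
      with Suc.prems(1) show False by simp
    qed
    then obtain k where k: "P i k * n_step P n k j \<noteq> 0" by blast
    moreover have "0 \<le> P i k" "0 \<le> n_step P n k j"
      using P n_step_bounds[OF P] by (auto simp: stochastic_kernel_def)
    ultimately have "P i k > 0" "n_step P n k j > 0" by (auto simp: less_le)
    then show ?case using Suc.IH[of k] closed Suc.prems by blast
  qed
qed

lemma stationary_measure_pos:
  assumes P: "stochastic_kernel P" and irr: "irreducible_kernel P" and st: "stationary_measure P \<nu>"
  shows "\<nu> j > 0"
proof -
  have nn: "\<nu> i \<ge> 0" for i using st by (simp add: stationary_measure_def)
  obtain i where "\<nu> i \<noteq> 0" using st by (auto simp: stationary_measure_def)
  then have "\<nu> i > 0" using nn[of i] by simp
  then show ?thesis
  proof (rule irreducible_closed_imp_all[OF P irr, where S = "\<lambda>i. \<nu> i > 0"])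
    fix i k assume "\<nu> i > 0" "P i k > 0"
    have s: "(\<lambda>i. \<nu> i * P i k) sums \<nu> k" using st by (simp add: stationary_measure_def)
    have "sum (\<lambda>i. \<nu> i * P i k) {i} \<le> (\<Sum>i. \<nu> i * P i k)"
      using s nn P by (intro sum_le_suminf) (auto simp: sums_iff stochastic_kernel_def)
    then have "\<nu> i * P i k \<le> \<nu> k" using s by (simp add: sums_iff)
    with \<open>\<nu> i > 0\<close> \<open>P i k > 0\<close> show "\<nu> k > 0" by (smt (verit) mult_pos_pos)
  qed
qed

text \<open>\<open>avoid_prob P j m i\<close> is the probability that the chain started in \<open>i\<close> does not visit \<open>j\<close> at
  the times \<open>1, \<dots>, m\<close>; the start itself may be \<open>j\<close>. The values are taken in \<open>ennreal\<close> so that sums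
  can be exchanged without side conditions.\<close>

primrec avoid_prob :: "(nat \<Rightarrow> nat \<Rightarrow> real) \<Rightarrow> nat \<Rightarrow> nat \<Rightarrow> nat \<Rightarrow> ennreal" where
  "avoid_prob P j 0 i = 1"
| "avoid_prob P j (Suc m) i = (\<Sum>k. if k = j then 0 else ennreal (P i k) * avoid_prob P j m k)"

lemma ennreal_suminf_swap:
  fixes f :: "nat \<Rightarrow> nat \<Rightarrow> ennreal"
  shows "(\<Sum>i. \<Sum>j. f i j) = (\<Sum>j. \<Sum>i. f i j)"
proof -
  have "(\<Sum>i. \<Sum>j. f i j) = (\<Sum>i. \<integral>\<^sup>+ j. f i j \<partial>count_space UNIV)"
    by (simp add: nn_integral_count_space_nat)
  also have "\<dots> = (\<integral>\<^sup>+ j. (\<Sum>i. f i j) \<partial>count_space UNIV)"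
    by (simp add: nn_integral_suminf)
  finally show ?thesis by (simp add: nn_integral_count_space_nat)
qed

lemma ennreal_suminf_remove:
  fixes g :: "nat \<Rightarrow> ennreal"
  shows "(\<Sum>k. g k) = (\<Sum>k. if k = j then 0 else g k) + g j"
proof -
  have "(\<Sum>k. if k = j then 0 else g k) + (\<Sum>k. if k = j then g k else 0)
      = (\<Sum>k. (if k = j then 0 else g k) + (if k = j then g k else 0))"
    by (rule suminf_add) auto
  also have "(\<lambda>k. (if k = j then 0 else g k) + (if k = j then g k else 0)) = g" by auto
  finally show ?thesis using sums_single[of j g] by (simp add: sums_iff)
qed

text \<open>The half of Kac's formula that holds without recurrence: \<open>\<Sum>m. avoid_prob P j m j\<close> is the
  mean return time to \<open>j\<close>, as a sum of its tail probabilities. One step of the chain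
  leaves \<open>\<nu>\<close> unchanged, so that requiring one further avoidance only removes the mass sitting in \<open>j\<close>,
  and the removed amounts add up to at most the total mass.\<close>

lemma stationary_avoid_sum_le:
  assumes nnP: "\<And>i k. 0 \<le> P i k" and st: "stationary_measure P \<nu>"
  shows "ennreal (\<nu> j) * (\<Sum>m. avoid_prob P j m j) \<le> (\<Sum>i. ennreal (\<nu> i))"
proof -
  define a where "a m = (\<Sum>i. ennreal (\<nu> i) * avoid_prob P j m i)" for m
  have nn: "\<nu> i \<ge> 0" for i using st by (simp add: stationary_measure_def)
  have inv: "(\<Sum>i. ennreal (\<nu> i) * ennreal (P i k)) = ennreal (\<nu> k)" for k
  proof -
    have "(\<lambda>i. \<nu> i * P i k) sums \<nu> k" using st by (simp add: stationary_measure_def)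
    then show ?thesis
      using nn nnP by (subst ennreal_mult[symmetric]) (auto intro!: suminf_ennreal_eq)
  qed
  have step: "a m = a (Suc m) + ennreal (\<nu> j) * avoid_prob P j m j" for m
  proof -
    have "a (Suc m) = (\<Sum>i. \<Sum>k. if k = j then 0 else
        ennreal (\<nu> i) * ennreal (P i k) * avoid_prob P j m k)"
      unfolding a_def avoid_prob.simps ennreal_suminf_cmult[symmetric]
      by (intro arg_cong[of _ _ suminf] ext) (auto simp: mult.assoc)
    also have "\<dots> = (\<Sum>k. \<Sum>i. if k = j then 0 else
        ennreal (\<nu> i) * ennreal (P i k) * avoid_prob P j m k)"
      by (rule ennreal_suminf_swap)
    also have "\<dots> = (\<Sum>k. if k = j then 0 else ennreal (\<nu> k) * avoid_prob P j m k)"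
      by (intro arg_cong[of _ _ suminf] ext) (auto simp: inv)
    finally show ?thesis
      unfolding a_def by (subst ennreal_suminf_remove[of _ j]) simp
  qed
  have tele: "a 0 = a N + (\<Sum>m<N. ennreal (\<nu> j) * avoid_prob P j m j)" for N
  proof (induction N)
    case (Suc N)
    then show ?case by (simp add: step[of N] ac_simps)
  qed simp
  have "(\<Sum>m. ennreal (\<nu> j) * avoid_prob P j m j) \<le> a 0"
  proof (rule suminf_le_const)
    fix N
    show "(\<Sum>m<N. ennreal (\<nu> j) * avoid_prob P j m j) \<le> a 0"
      unfolding tele[of N] by (rule add_increasing) auto
  qed simp
  then show ?thesis by (simp add: a_def)
qed

section \<open>The Markov property and return times\<close>

locale markov = prob_space \<Omega>
  for \<Omega> :: "'a measure" and P :: "nat \<Rightarrow> nat \<Rightarrow> real" and X :: "nat \<Rightarrow> 'a \<Rightarrow> nat" +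
  assumes chain: "markov_chain \<Omega> P X" and nonneg: "0 \<le> P i k"
begin

lemma X_measurable [measurable]: "X m \<in> measurable \<Omega> (count_space UNIV)"
  using chain by (simp add: markov_chain_def)

lemma emeasure_partition_X:
  assumes [measurable]: "A \<in> sets \<Omega>"
  shows "emeasure \<Omega> A = (\<Sum>v. emeasure \<Omega> {\<omega> \<in> A. X l \<omega> = v})"
proof -
  have sub: "\<omega> \<in> A \<Longrightarrow> \<omega> \<in> space \<Omega>" for \<omega> using assms sets.sets_into_space by blast
  have A: "{\<omega> \<in> A. X l \<omega> = v} = A \<inter> {\<omega> \<in> space \<Omega>. X l \<omega> = v}" for v using sub by auto
  have "(\<Sum>v. emeasure \<Omega> {\<omega> \<in> A. X l \<omega> = v}) = emeasure \<Omega> (\<Union>v. {\<omega> \<in> A. X l \<omega> = v})"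
    by (rule suminf_emeasure) (auto simp: disjoint_family_on_def A)
  also have "(\<Union>v. {\<omega> \<in> A. X l \<omega> = v}) = A" by auto
  finally show ?thesis by simp
qed

lemma emeasure_next_step:
  "emeasure \<Omega> {\<omega> \<in> space \<Omega>. (\<forall>k\<le>n. X k \<omega> = x k) \<and> X (Suc n) \<omega> = v} =
   emeasure \<Omega> {\<omega> \<in> space \<Omega>. \<forall>k\<le>n. X k \<omega> = x k} * ennreal (P (x n) v)"
proof -
  let ?H = "{\<omega> \<in> space \<Omega>. \<forall>k\<le>n. X k \<omega> = x k}"
  let ?N = "{\<omega> \<in> space \<Omega>. (\<forall>k\<le>n. X k \<omega> = x k) \<and> X (Suc n) \<omega> = v}"
  have "prob ?N = prob ?H * P (x n) v"
  proof (cases "prob ?H > 0")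
    case True
    then have "\<P>(\<omega> in \<Omega>. X (Suc n) \<omega> = v \<bar> \<forall>k\<le>n. X k \<omega> = x k) = P (x n) v"
      using chain by (simp add: markov_chain_def)
    with True show ?thesis
      by (simp add: cond_prob_def field_simps conj_commute)
  next
    case False
    then have "prob ?H = 0" by (simp add: zero_less_measure_iff)
    moreover have "prob ?N \<le> prob ?H" by (intro finite_measure_mono) auto
    ultimately have "prob ?N = 0" using measure_nonneg[of \<Omega> ?N] by linarith
    then show ?thesis using \<open>prob ?H = 0\<close> by simp
  qed
  then show ?thesis by (simp add: emeasure_eq_measure ennreal_mult nonneg)
qed

text \<open>The hypothesis on the chain speaks of complete histories. If an event \<open>B\<close> has a conditional
  probability that depends only on the last state of the history, then the rest of the history can
  be discarded. It is discarded one time index at a time, from the oldest on, by summing over the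
  value of \<open>X l\<close>; so no sum over histories is needed.\<close>

lemma forget_past:
  assumes B [measurable]: "Measurable.pred \<Omega> B"
    and full: "\<And>x. emeasure \<Omega> {\<omega> \<in> space \<Omega>. (\<forall>k\<le>n. X k \<omega> = x k) \<and> B \<omega>} =
      emeasure \<Omega> {\<omega> \<in> space \<Omega>. \<forall>k\<le>n. X k \<omega> = x k} * c (x n)"
  shows "emeasure \<Omega> {\<omega> \<in> space \<Omega>. X n \<omega> = i \<and> B \<omega>} =
    emeasure \<Omega> {\<omega> \<in> space \<Omega>. X n \<omega> = i} * c i"
proof -
  have "emeasure \<Omega> {\<omega> \<in> space \<Omega>. (\<forall>k\<in>{l..n}. X k \<omega> = x k) \<and> B \<omega>} =
      emeasure \<Omega> {\<omega> \<in> space \<Omega>. \<forall>k\<in>{l..n}. X k \<omega> = x k} * c (x n)" if "l \<le> n" for l x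
    using that
  proof (induction l arbitrary: x)
    case 0
    show ?case using full[of x] by (simp add: Ball_def)
  next
    case (Suc l)
    have upd: "(\<forall>k\<in>{l..n}. X k \<omega> = (x(l := v)) k) \<longleftrightarrow>
        (\<forall>k\<in>{Suc l..n}. X k \<omega> = x k) \<and> X l \<omega> = v" for \<omega> v
      using Suc.prems by (auto simp: Suc_le_eq le_less)
    have last: "(x(l := v)) n = x n" for v using Suc.prems by simp
    have IH: "emeasure \<Omega> {\<omega> \<in> space \<Omega>. ((\<forall>k\<in>{Suc l..n}. X k \<omega> = x k) \<and> X l \<omega> = v) \<and> B \<omega>} =
      emeasure \<Omega> {\<omega> \<in> space \<Omega>. (\<forall>k\<in>{Suc l..n}. X k \<omega> = x k) \<and> X l \<omega> = v} * c (x n)" for v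
      using Suc.IH[of "x(l := v)"] Suc.prems unfolding upd last by simp
    let ?H = "{\<omega> \<in> space \<Omega>. \<forall>k\<in>{Suc l..n}. X k \<omega> = x k}"
    let ?HB = "{\<omega> \<in> space \<Omega>. (\<forall>k\<in>{Suc l..n}. X k \<omega> = x k) \<and> B \<omega>}"
    have H: "{\<omega> \<in> ?H. X l \<omega> = v} =
        {\<omega> \<in> space \<Omega>. (\<forall>k\<in>{Suc l..n}. X k \<omega> = x k) \<and> X l \<omega> = v}" for v by auto
    have HB: "{\<omega> \<in> ?HB. X l \<omega> = v} =
        {\<omega> \<in> space \<Omega>. ((\<forall>k\<in>{Suc l..n}. X k \<omega> = x k) \<and> X l \<omega> = v) \<and> B \<omega>}" for v by auto
    have "emeasure \<Omega> ?HB = (\<Sum>v. emeasure \<Omega> {\<omega> \<in> ?HB. X l \<omega> = v})"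
      by (rule emeasure_partition_X) measurable
    also have "\<dots> = (\<Sum>v. emeasure \<Omega> {\<omega> \<in> ?H. X l \<omega> = v}) * c (x n)"
      unfolding H HB IH by (rule ennreal_suminf_multc)
    also have "(\<Sum>v. emeasure \<Omega> {\<omega> \<in> ?H. X l \<omega> = v}) = emeasure \<Omega> ?H"
      by (rule emeasure_partition_X[symmetric]) measurable
    finally show ?case .
  qed
  from this[of n "\<lambda>_. i"] show ?thesis by simp
qed

text \<open>The history has to be arbitrary in the induction on \<open>m\<close>: splitting by the value of
  \<open>X (Suc n)\<close> extends the history by one state and leaves one state fewer to avoid.\<close>

lemma emeasure_avoid_history:
  "emeasure \<Omega> {\<omega> \<in> space \<Omega>. (\<forall>k\<le>n. X k \<omega> = x k) \<and> (\<forall>k\<in>{1..m}. X (n + k) \<omega> \<noteq> j)} =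
   emeasure \<Omega> {\<omega> \<in> space \<Omega>. \<forall>k\<le>n. X k \<omega> = x k} * avoid_prob P j m (x n)"
proof (induction m arbitrary: n x)
  case (Suc m)
  let ?H = "{\<omega> \<in> space \<Omega>. \<forall>k\<le>n. X k \<omega> = x k}"
  let ?A = "{\<omega> \<in> space \<Omega>. (\<forall>k\<le>n. X k \<omega> = x k) \<and> (\<forall>k\<in>{1..Suc m}. X (n + k) \<omega> \<noteq> j)}"
  have shift: "(\<forall>k\<in>{1..Suc m}. X (n + k) \<omega> \<noteq> j) \<longleftrightarrow>
      X (Suc n) \<omega> \<noteq> j \<and> (\<forall>k\<in>{1..m}. X (Suc n + k) \<omega> \<noteq> j)" for \<omega>
  proof -
    have *: "{1..Suc m} = insert 1 (Suc ` {1..m})" by (auto simp: image_Suc_atLeastAtMost)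
    show ?thesis unfolding * by (auto simp del: image_Suc_atLeastAtMost)
  qed
  have upd: "(\<forall>k\<le>Suc n. X k \<omega> = (x(Suc n := v)) k) \<longleftrightarrow>
      (\<forall>k\<le>n. X k \<omega> = x k) \<and> X (Suc n) \<omega> = v" for \<omega> v
    by (auto simp: le_Suc_eq)
  have split: "emeasure \<Omega> {\<omega> \<in> ?A. X (Suc n) \<omega> = v} =
      emeasure \<Omega> ?H * (if v = j then 0 else ennreal (P (x n) v) * avoid_prob P j m v)" for v
  proof (cases "v = j")
    case True
    then have empty: "{\<omega> \<in> ?A. X (Suc n) \<omega> = v} = {}" unfolding shift by auto
    show ?thesis unfolding empty using True by simp
  next
    case False
    then have "{\<omega> \<in> ?A. X (Suc n) \<omega> = v} = {\<omega> \<in> space \<Omega>.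
        (\<forall>k\<le>Suc n. X k \<omega> = (x(Suc n := v)) k) \<and> (\<forall>k\<in>{1..m}. X (Suc n + k) \<omega> \<noteq> j)}"
      unfolding upd shift by auto
    then have "emeasure \<Omega> {\<omega> \<in> ?A. X (Suc n) \<omega> = v} =
        emeasure \<Omega> {\<omega> \<in> space \<Omega>. \<forall>k\<le>Suc n. X k \<omega> = (x(Suc n := v)) k}
          * avoid_prob P j m ((x(Suc n := v)) (Suc n))"
      using Suc.IH[of "Suc n" "x(Suc n := v)"] by (simp only:)
    then show ?thesis
      unfolding upd emeasure_next_step using False by (simp add: mult.assoc)
  qed
  have "emeasure \<Omega> ?A = (\<Sum>v. emeasure \<Omega> {\<omega> \<in> ?A. X (Suc n) \<omega> = v})"
    by (rule emeasure_partition_X) measurable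
  also have "\<dots> = emeasure \<Omega> ?H * avoid_prob P j (Suc m) (x n)"
    unfolding split by simp
  finally show ?case .
qed simp

lemma visit_next:
  assumes "prob {\<omega> \<in> space \<Omega>. X n \<omega> = i} > 0" "P i v > 0"
  shows "prob {\<omega> \<in> space \<Omega>. X (Suc n) \<omega> = v} > 0"
proof -
  have "emeasure \<Omega> {\<omega> \<in> space \<Omega>. X n \<omega> = i \<and> X (Suc n) \<omega> = v} =
      emeasure \<Omega> {\<omega> \<in> space \<Omega>. X n \<omega> = i} * ennreal (P i v)"
    by (rule forget_past[where c = "\<lambda>i. ennreal (P i v)"]) (simp_all add: emeasure_next_step)
  then have "prob {\<omega> \<in> space \<Omega>. X n \<omega> = i \<and> X (Suc n) \<omega> = v} =
      prob {\<omega> \<in> space \<Omega>. X n \<omega> = i} * P i v"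
    using nonneg by (simp add: emeasure_eq_measure ennreal_mult[symmetric])
  then have "0 < prob {\<omega> \<in> space \<Omega>. X n \<omega> = i \<and> X (Suc n) \<omega> = v}" using assms by simp
  also have "\<dots> \<le> prob {\<omega> \<in> space \<Omega>. X (Suc n) \<omega> = v}"
    by (intro finite_measure_mono) auto
  finally show ?thesis .
qed

text \<open>The time of the first return counts the \<open>m\<close> for which no return occurs up to time \<open>m\<close>, starting
  from \<open>m = 0\<close>. A series of indicators, unlike the infimum, can be integrated term by term.\<close>

lemma return_time_le:
  "return_time X n j \<omega> \<le> (\<Sum>m. indicator {\<omega>. \<forall>k\<in>{1..m}. X (n + k) \<omega> \<noteq> j} \<omega>)"
proof (cases "\<exists>m\<ge>1. X (n + m) \<omega> = j")
  case True
  define t where "t = (LEAST m. m \<ge> 1 \<and> X (n + m) \<omega> = j)"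
  have t: "t \<ge> 1 \<and> X (n + t) \<omega> = j" unfolding t_def by (rule LeastI_ex) (use True in blast)
  have before: "X (n + k) \<omega> \<noteq> j" if "k \<ge> 1" "k < t" for k
    using not_less_Least[of k "\<lambda>m. m \<ge> 1 \<and> X (n + m) \<omega> = j"] that unfolding t_def by blast
  have "return_time X n j \<omega> \<le> of_nat t"
    unfolding return_time_def using t by (intro INF_lower) auto
  also have "of_nat t = (\<Sum>m<t. indicator {\<omega>. \<forall>k\<in>{1..m}. X (n + k) \<omega> \<noteq> j} \<omega> :: ennreal)"
    using before by (simp add: indicator_def)
  also have "\<dots> \<le> (\<Sum>m. indicator {\<omega>. \<forall>k\<in>{1..m}. X (n + k) \<omega> \<noteq> j} \<omega>)"
    by (rule sum_le_suminf) auto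
  finally show ?thesis .
next
  case False
  then have "(\<Sum>m. indicator {\<omega>. \<forall>k\<in>{1..m}. X (n + k) \<omega> \<noteq> j} \<omega> :: ennreal) = (\<Sum>m. 1)"
    by (intro arg_cong[of _ _ suminf] ext) (auto simp: indicator_def)
  also have "\<dots> = \<infinity>"
    using nn_integral_count_space_nat[of "\<lambda>_. 1"] by (simp add: ennreal_mult_top)
  finally show ?thesis by simp
qed

lemma mean_return_time_le:
  assumes pos: "prob {\<omega> \<in> space \<Omega>. X n \<omega> = j} > 0"
  shows "mean_return_time \<Omega> X n j \<le> (\<Sum>m. avoid_prob P j m j)"
proof -
  let ?A = "{\<omega> \<in> space \<Omega>. X n \<omega> = j}"
  have A: "emeasure \<Omega> ?A \<noteq> 0" "emeasure \<Omega> ?A \<noteq> \<infinity>"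
    using pos by (auto simp: emeasure_eq_measure)
  have avoid: "emeasure \<Omega> {\<omega> \<in> space \<Omega>. X n \<omega> = j \<and> (\<forall>k\<in>{1..m}. X (n + k) \<omega> \<noteq> j)} =
      emeasure \<Omega> ?A * avoid_prob P j m j" for m
    by (rule forget_past[where c = "avoid_prob P j m"], measurable) (rule emeasure_avoid_history)
  let ?B = "\<lambda>m. {\<omega> \<in> space \<Omega>. \<forall>k\<in>{1..m}. X (n + k) \<omega> \<noteq> j}"
  have B [measurable]: "?B m \<in> sets \<Omega>" for m by measurable
  have "mean_return_time \<Omega> X n j
      \<le> (\<integral>\<^sup>+ \<omega>. (\<Sum>m. indicator (?B m) \<omega>) \<partial>uniform_measure \<Omega> ?A)"
    unfolding mean_return_time_def
  proof (rule nn_integral_mono)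
    fix \<omega> assume "\<omega> \<in> space (uniform_measure \<Omega> ?A)"
    then have "indicator (?B m) \<omega>
        = (indicator {\<omega>. \<forall>k\<in>{1..m}. X (n + k) \<omega> \<noteq> j} \<omega> :: ennreal)" for m
      by (simp add: indicator_def)
    then show "return_time X n j \<omega> \<le> (\<Sum>m. indicator (?B m) \<omega>)"
      using return_time_le by presburger
  qed
  also have "\<dots> = (\<Sum>m. emeasure (uniform_measure \<Omega> ?A) (?B m))"
    by (subst nn_integral_suminf) auto
  also have "\<dots> = (\<Sum>m. avoid_prob P j m j)"
  proof (intro arg_cong[of _ _ suminf] ext)
    fix m
    have "?A \<inter> ?B m = {\<omega> \<in> space \<Omega>. X n \<omega> = j \<and> (\<forall>k\<in>{1..m}. X (n + k) \<omega> \<noteq> j)}" by auto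
    then have "emeasure \<Omega> (?A \<inter> ?B m) = avoid_prob P j m j * emeasure \<Omega> ?A"
      by (simp only: avoid mult.commute)
    then show "emeasure (uniform_measure \<Omega> ?A) (?B m) = avoid_prob P j m j"
      using A by (subst emeasure_uniform_measure) (auto simp: ennreal_mult_divide_eq)
  qed
  finally show ?thesis .
qed

text \<open>Some state is visited with positive probability at time \<open>0\<close>, hence every state is visited at
  some time. An infinite mean return time would contradict the bound by the total mass, as
  \<open>\<nu> j > 0\<close>.\<close>

lemma positive_recurrentI:
  assumes P: "stochastic_kernel P" and irr: "irreducible_kernel P"
    and st: "stationary_measure P \<nu>" and sm: "summable \<nu>"
    and start: "AE \<omega> in \<Omega>. X 0 \<omega> = i"
  shows "positive_recurrent \<Omega> X"
  unfolding positive_recurrent_def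
proof (intro allI conjI impI)
  fix j
  have "prob {\<omega> \<in> space \<Omega>. X 0 \<omega> = i} = 1"
    using start by (intro prob_eq_1[THEN iffD2]) auto
  then have "\<exists>n. prob {\<omega> \<in> space \<Omega>. X n \<omega> = i} > 0" by (intro exI[of _ 0]) simp
  then show "\<exists>n. prob {\<omega> \<in> space \<Omega>. X n \<omega> = j} > 0"
    by (rule irreducible_closed_imp_all[OF P irr,
          where S = "\<lambda>i. \<exists>n. prob {\<omega> \<in> space \<Omega>. X n \<omega> = i} > 0"])
      (use visit_next in blast)
next
  fix j n assume "prob {\<omega> \<in> space \<Omega>. X n \<omega> = j} > 0"
  then have "mean_return_time \<Omega> X n j \<le> (\<Sum>m. avoid_prob P j m j)"
    by (rule mean_return_time_le)
  also have "\<dots> < \<infinity>"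
  proof (rule ccontr)
    assume "\<not> ?thesis"
    then have "(\<Sum>m. avoid_prob P j m j) = \<infinity>" by (simp add: not_less top_unique)
    moreover have "\<nu> j > 0" by (rule stationary_measure_pos[OF P irr st])
    ultimately have "ennreal (\<nu> j) * (\<Sum>m. avoid_prob P j m j) = \<infinity>"
      by (simp add: ennreal_mult_top)
    moreover have "(\<Sum>i. ennreal (\<nu> i)) \<noteq> \<infinity>"
      unfolding infinity_ennreal_def
      by (rule ennreal_suminf_neq_top[OF sm]) (use st in \<open>simp add: stationary_measure_def\<close>)
    ultimately show False
      using stationary_avoid_sum_le[OF nonneg st, of j] neq_top_trans
      unfolding infinity_ennreal_def by metis
  qed
  finally show "mean_return_time \<Omega> X n j < \<infinity>" .
qed

end

section \<open>Stationary measure and positive recurrence of the walk\<close>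

theorem theorem1p1:
  fixes R :: nat
    and r q :: "nat \<Rightarrow> real"
    and p :: "nat \<Rightarrow> nat \<Rightarrow> real"
    and \<Omega> :: "'a measure"
    and X :: "nat \<Rightarrow> 'a \<Rightarrow> nat"
  assumes "R \<ge> 1"
    and "\<And>i. r i \<ge> 0"
    and "\<And>k i. 1 \<le> k \<Longrightarrow> k \<le> R \<Longrightarrow> p k i \<ge> 0"
    and "\<And>i. r i + q i + (\<Sum>k=1..R. p k i) = 1"
    and "q 0 = 0"
    and "\<And>i. i \<ge> 1 \<Longrightarrow> 0 < q i \<and> q i < 1"
    and "irreducible_kernel (walk_kernel R r q p)"
    and "markov_chain \<Omega> (walk_kernel R r q p) X"
    and "AE \<omega> in \<Omega>. X 0 \<omega> = 0"
  shows "stationary_measure (walk_kernel R r q p) (\<mu> R q p) \<and>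
    (summable (\<mu> R q p) \<longrightarrow>
       positive_recurrent \<Omega> X \<and>
       (\<forall>\<nu>. stationary_distribution (walk_kernel R r q p) \<nu> \<longleftrightarrow>
            \<nu> = (\<lambda>i. \<mu> R q p i / (\<Sum>j. \<mu> R q p j))))"
proof -
  let ?W = "walk_kernel R r q p" and ?\<mu> = "\<mu> R q p"
  have qpos: "\<And>i. i \<ge> 1 \<Longrightarrow> 0 < q i" using assms(6) by blast
  note cut = \<mu>_cut_equations[where q = q and p = p, OF assms(1,5) qpos]
  have W: "stochastic_kernel ?W" by (rule stochastic_walk_kernel
        [where q = q and r = r and p = p, OF assms(2-5) qpos])
  have \<mu>0: "?\<mu> 0 = 1" by (simp add: \<mu>_def)
  note invariant_iff =
    invariant_iff_cut_equations[where R = R and r = r and q = q and p = p, OF assms(4,5)]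
  have "\<forall>j. (\<lambda>i. ?\<mu> i * ?W i j) sums ?\<mu> j"
    unfolding invariant_iff using cut by blast
  then have st: "stationary_measure ?W ?\<mu>"
    unfolding stationary_measure_def
    using \<mu>_nonneg[where q = q and p = p, OF assms(1,5) qpos assms(3)] \<mu>0 by (metis zero_neq_one)
  have "markov \<Omega> ?W X"
    using assms(8) W
    by (auto simp: markov_def markov_axioms_def markov_chain_def stochastic_kernel_def)
  then interpret markov \<Omega> ?W X .
  have pr: "positive_recurrent \<Omega> X" if "summable ?\<mu>"
    by (rule positive_recurrentI[OF W assms(7) st that assms(9)])
  have uniq: "stationary_distribution ?W \<nu> \<longleftrightarrow> \<nu> = (\<lambda>i. ?\<mu> i / (\<Sum>j. ?\<mu> j))"
    if sm: "summable ?\<mu>" for \<nu>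
  proof -
    have nn: "0 \<le> ?\<mu> i" for i using st by (simp add: stationary_measure_def)
    have "sum ?\<mu> {0} \<le> (\<Sum>j. ?\<mu> j)" by (rule sum_le_suminf[OF sm]) (auto simp: nn)
    then have Z: "(\<Sum>j. ?\<mu> j) > 0" by (simp add: \<mu>0)
    show ?thesis
    proof
      assume sd: "stationary_distribution ?W \<nu>"
      then have "\<forall>j. (\<lambda>i. \<nu> i * ?W i j) sums \<nu> j"
        by (simp add: stationary_distribution_def stationary_measure_def)
      then have c: "\<And>j. \<nu> j * q j = (\<Sum>i<j. \<nu> i * jump_tail R p (j - i) i)"
        unfolding invariant_iff by blast
      have eq: "\<nu> j = \<nu> 0 * ?\<mu> j" for j
        by (rule cut_equations_unique[where q = q and \<nu> = \<nu> and \<rho> = ?\<mu>, OF qpos c cut \<mu>0])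
      have "\<nu> sums (\<nu> 0 * (\<Sum>j. ?\<mu> j))"
        by (subst eq[abs_def]) (use sm in \<open>auto intro: sums_mult summable_sums\<close>)
      moreover have "\<nu> sums 1" using sd by (simp add: stationary_distribution_def)
      ultimately have "\<nu> 0 * (\<Sum>j. ?\<mu> j) = 1" by (rule sums_unique2)
      then have "\<nu> 0 = 1 / (\<Sum>j. ?\<mu> j)" using Z by (simp add: field_simps)
      then show "\<nu> = (\<lambda>i. ?\<mu> i / (\<Sum>j. ?\<mu> j))" using eq by (metis mult_1 times_divide_eq_left)
    next
      assume \<nu>: "\<nu> = (\<lambda>i. ?\<mu> i / (\<Sum>j. ?\<mu> j))"
      have "(\<lambda>i. ?\<mu> i * ?W i j / (\<Sum>j. ?\<mu> j)) sums (?\<mu> j / (\<Sum>j. ?\<mu> j))" for j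
        using st by (intro sums_divide) (simp add: stationary_measure_def)
      moreover have "?\<mu> 0 / (\<Sum>j. ?\<mu> j) \<noteq> 0" using Z \<mu>0 by simp
      ultimately have "stationary_measure ?W \<nu>"
        unfolding stationary_measure_def \<nu> using nn Z
        by (auto simp: field_simps intro: exI[of _ 0])
      moreover have "\<nu> sums 1"
        unfolding \<nu> using sums_divide[OF summable_sums[OF sm], of "\<Sum>j. ?\<mu> j"] Z by simp
      ultimately show "stationary_distribution ?W \<nu>" by (simp add: stationary_distribution_def)
    qed
  qed
  show ?thesis using st pr uniq by blast
qed

end
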